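(* Every countably compact Tychonoff $\Delta$-space is scattered.
   Context: A topological space $X$ is a $\Delta$-space if for every decreasing sequence $\{D_n: n \in \omega\}$ of subsets of $X$ with empty intersection there is a decreasing sequence $\{V_n: n \in \omega\}$ of open subsets of $X$, also with empty intersection, such that $D_n \subset V_n$ for every $n \in \omega$. A space is scattered if every nonempty subset $A$ of it has a point isolated in $A$. *)

theory Defs
  imports "HOL-Analysis.Analysis"
begin

text \<open>Abstract-topology counterpart of the type-class predicate \<open>countably_compact\<close>.\<close>

definition countably_compact_space :: "'a topology \<Rightarrow> bool" where
  "countably_compact_space X \<longleftrightarrow>
     (\<forall>\<U>. countable \<U> \<and> (\<forall>U\<in>\<U>. openin X U) \<and> \<Union>\<U> = topspace X
        \<longrightarrow> (\<exists>\<V>. finite \<V> \<and> \<V> \<subseteq> \<U> \<and> \<Union>\<V> = topspace X))"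

definition Tychonoff_space :: "'a topology \<Rightarrow> bool" where
  "Tychonoff_space X \<longleftrightarrow> completely_regular_space X \<and> t1_space X"

text \<open>``Decreasing'' is meant in the weak sense, as in \<^const>\<open>decseq\<close>.\<close>

definition Delta_space :: "'a topology \<Rightarrow> bool" where
  "Delta_space X \<longleftrightarrow>
     (\<forall>D :: nat \<Rightarrow> 'a set. (\<forall>n. D n \<subseteq> topspace X) \<and> decseq D \<and> (\<Inter>n. D n) = {}
        \<longrightarrow> (\<exists>V :: nat \<Rightarrow> 'a set. (\<forall>n. openin X (V n)) \<and> decseq V \<and> (\<Inter>n. V n) = {}
               \<and> (\<forall>n. D n \<subseteq> V n)))"

definition scattered_space :: "'a topology \<Rightarrow> bool" where
  "scattered_space X \<longleftrightarrow>
     (\<forall>A. A \<subseteq> topspace X \<and> A \<noteq> {} \<longrightarrow> (\<exists>x\<in>A. openin (subtopology X A) {x}))"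

end

theory Submission
  imports Defs
begin

text \<open>
  Suppose that \<open>A\<close> is a nonempty set without isolated points in a countably compact regular
  Hausdorff space \<open>X\<close>. Repeatedly splitting open sets that meet \<open>A\<close> into two smaller ones with
  disjoint closures yields a binary tree of cells. The closures of the cells along a branch
  \<open>\<sigma>\<close> intersect in a closed set, the fibre of \<open>\<sigma>\<close>, and fibres of distinct branches are
  disjoint. In effect the fibres are those of a continuous map from a closed subset of \<open>X\<close> onto
  the Cantor space, and what follows is the Baire category argument showing that the Cantor space
  is not a \<open>\<Delta>\<close>-space, carried out upstairs.

  Let \<open>D\<^sub>n\<close> be the union of the fibres of those branches that have only finitely many, but at
  least \<open>n\<close>, entries \<open>True\<close>. The sets \<open>D\<^sub>n\<close> decrease to the empty set, because a point lies on
  one branch only. On the other hand such branches pass through every node of the tree. So, if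
  \<open>V\<^sub>n\<close> are open with \<open>D\<^sub>n \<subseteq> V\<^sub>n\<close>, below every node there is a branch whose fibre
  lies in \<open>V\<^sub>n\<close>, and by countable compactness the closure of some cell on that branch already
  lies in \<open>V\<^sub>n\<close> (\<open>cell_below_with_closure_in\<close>). Iterating over \<open>n\<close> gives decreasing cells with the
  \<open>n\<close>-th closure inside \<open>V\<^sub>n\<close>; by countable compactness these closures have a common point,
  so the \<open>V\<^sub>n\<close> cannot have empty intersection.
\<close>

section \<open>Countable compactness and splitting of open sets\<close>

text \<open>
  The form of countable compactness used throughout: the open sets \<open>U\<close> and the complements of the
  \<open>C n\<close> cover \<open>X\<close>, and these complements increase. With \<open>U = {}\<close> it is the Cantor intersection property.
\<close>

lemma countably_compact_decseq_closed_subset_open: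
  fixes C :: "nat \<Rightarrow> 'a set"
  assumes cc: "countably_compact_space X"
    and closed: "\<And>n. closedin X (C n)" and dec: "decseq C"
    and U: "openin X U" and sub: "(\<Inter>n. C n) \<subseteq> U"
  obtains n where "C n \<subseteq> U"
proof -
  let ?\<U> = "insert U (range (\<lambda>n. topspace X - C n))"
  have "countable ?\<U>" by simp
  moreover have "\<forall>W\<in>?\<U>. openin X W"
    using U closed by auto
  moreover have "\<Union>?\<U> = topspace X"
    using openin_subset[OF U] sub by auto
  ultimately have "\<exists>\<V>. finite \<V> \<and> \<V> \<subseteq> ?\<U> \<and> \<Union>\<V> = topspace X"
    using cc unfolding countably_compact_space_def by meson
  then obtain \<V> where \<V>: "finite \<V>" "\<V> \<subseteq> ?\<U>" "\<Union>\<V> = topspace X"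
    by (elim exE conjE) (rule that)
  have "finite (\<V> - {U})" "\<V> - {U} \<subseteq> (\<lambda>n. topspace X - C n) ` UNIV"
    using \<V> by auto
  then obtain I :: "nat set" where I: "finite I" "\<V> - {U} = (\<lambda>n. topspace X - C n) ` I"
    by (meson finite_subset_image)
  obtain m where m: "\<And>i. i \<in> I \<Longrightarrow> i \<le> m"
    using I(1) unfolding finite_nat_set_iff_bounded_le by blast
  have "C m \<subseteq> U"
  proof
    fix x assume x: "x \<in> C m"
    then have "x \<in> \<Union>\<V>"
      using closedin_subset[OF closed] \<V>(3) by blast
    moreover have "x \<in> C i" if "i \<in> I" for i
      using decseqD[OF dec m[OF that]] x by blast
    ultimately show "x \<in> U"
      using I(2) by blast
  qed
  then show thesis by (rule that)
qed

lemma regular_space_open_shrink: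
  assumes "regular_space X" "openin X U" "x \<in> U"
  obtains V where "openin X V" "x \<in> V" "X closure_of V \<subseteq> U"
proof -
  obtain V K where "openin X V" "closedin X K" "x \<in> V" "V \<subseteq> K" "K \<subseteq> U"
    using assms neighbourhood_base_of_closedin[of X] unfolding neighbourhood_base_of by metis
  then show thesis
    using that[of V] closure_of_minimal by (metis subset_trans)
qed

lemma crowded_open_split:
  assumes reg: "regular_space X" and haus: "Hausdorff_space X"
    and A: "A \<subseteq> topspace X" and crowded: "\<And>x. x \<in> A \<Longrightarrow> \<not> openin (subtopology X A) {x}"
    and U: "openin X U" "U \<inter> A \<noteq> {}"
  obtains S :: "bool \<Rightarrow> 'a set"
    where "\<And>b. openin X (S b)" "\<And>b. S b \<inter> A \<noteq> {}" "\<And>b. X closure_of S b \<subseteq> U"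
      "disjnt (X closure_of S False) (X closure_of S True)"
proof -
  obtain x where x: "x \<in> U" "x \<in> A"
    using U by blast
  have "U \<inter> A \<noteq> {x}"
    using crowded[OF x(2)] U(1) openin_subtopology by metis
  then obtain y where y: "y \<in> U" "y \<in> A" "y \<noteq> x"
    using x by blast
  obtain P Q where PQ: "openin X P" "openin X Q" "x \<in> P" "y \<in> Q" "disjnt P Q"
    using haus x y A unfolding Hausdorff_space_def by (metis subsetD)
  obtain V where V: "openin X V" "x \<in> V" "X closure_of V \<subseteq> U \<inter> P"
    using regular_space_open_shrink[OF reg, of "U \<inter> P" x] U PQ x by blast
  obtain W where W: "openin X W" "y \<in> W" "X closure_of W \<subseteq> U \<inter> Q"
    using regular_space_open_shrink[OF reg, of "U \<inter> Q" y] U PQ y by blast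
  show thesis
  proof (rule that[of "\<lambda>b. if b then W else V"])
    show "disjnt (X closure_of (if False then W else V)) (X closure_of (if True then W else V))"
      using V W PQ(5) unfolding disjnt_def by auto
  qed (use V W x y in auto)
qed

section \<open>The tree of cells and the Baire category argument\<close>

text \<open>
  The function \<open>S\<close> chooses the two halves of every open set that meets \<open>A\<close>. A node of the binary
  tree is given by a branch through it and its depth; only the entries below the depth matter.
\<close>

locale splitting_scheme =
  fixes X :: "'a topology" and A :: "'a set" and S :: "'a set \<Rightarrow> bool \<Rightarrow> 'a set"
  assumes root: "topspace X \<inter> A \<noteq> {}"
    and split_open: "\<lbrakk>openin X U; U \<inter> A \<noteq> {}\<rbrakk> \<Longrightarrow> openin X (S U b)"
    and split_meets: "\<lbrakk>openin X U; U \<inter> A \<noteq> {}\<rbrakk> \<Longrightarrow> S U b \<inter> A \<noteq> {}"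
    and split_closure: "\<lbrakk>openin X U; U \<inter> A \<noteq> {}\<rbrakk> \<Longrightarrow> X closure_of S U b \<subseteq> U"
    and split_disjnt: "\<lbrakk>openin X U; U \<inter> A \<noteq> {}\<rbrakk> \<Longrightarrow>
          disjnt (X closure_of S U False) (X closure_of S U True)"
begin

primrec cell :: "(nat \<Rightarrow> bool) \<Rightarrow> nat \<Rightarrow> 'a set" where
  "cell \<sigma> 0 = topspace X"
| "cell \<sigma> (Suc k) = S (cell \<sigma> k) (\<sigma> k)"

definition fibre :: "(nat \<Rightarrow> bool) \<Rightarrow> 'a set" where
  "fibre \<sigma> = (\<Inter>k. X closure_of cell \<sigma> k)"

lemma cell_open_meets: "openin X (cell \<sigma> k) \<and> cell \<sigma> k \<inter> A \<noteq> {}"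
  by (induction k) (use root split_open split_meets in auto)

lemmas cell_open = cell_open_meets[THEN conjunct1]
  and cell_meets = cell_open_meets[THEN conjunct2]

lemma cell_cong: "(\<And>i. i < k \<Longrightarrow> \<sigma> i = \<tau> i) \<Longrightarrow> cell \<sigma> k = cell \<tau> k"
  by (induction k) auto

lemma decseq_cell: "decseq (cell \<sigma>)"
proof (rule decseq_SucI)
  fix k
  have "cell \<sigma> (Suc k) \<subseteq> X closure_of cell \<sigma> (Suc k)"
    using cell_open by (intro closure_of_subset openin_subset)
  also have "\<dots> \<subseteq> cell \<sigma> k"
    using split_closure[OF cell_open cell_meets] by simp
  finally show "cell \<sigma> (Suc k) \<subseteq> cell \<sigma> k" .
qed

lemma decseq_closure_cell: "decseq (\<lambda>k. X closure_of cell \<sigma> k)"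
  using decseq_cell[of \<sigma>] by (simp add: decseq_def closure_of_mono)

text \<open>Two distinct branches part at their first difference, into disjoint halves of one cell.\<close>

lemma fibre_inj:
  assumes "x \<in> fibre \<sigma>" "x \<in> fibre \<tau>"
  shows "\<sigma> = \<tau>"
proof (rule ccontr)
  assume "\<sigma> \<noteq> \<tau>"
  then have "\<exists>k. \<sigma> k \<noteq> \<tau> k" by auto
  then obtain k where k: "\<sigma> k \<noteq> \<tau> k" "\<And>i. i < k \<Longrightarrow> \<sigma> i = \<tau> i"
    using exists_least_iff[of "\<lambda>k. \<sigma> k \<noteq> \<tau> k"] by blast
  have same: "cell \<tau> k = cell \<sigma> k"
    using k(2) by (metis cell_cong)
  have "x \<in> X closure_of S (cell \<sigma> k) (\<sigma> k)" "x \<in> X closure_of S (cell \<sigma> k) (\<tau> k)"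
    using assms same unfolding fibre_def by (metis INT_E UNIV_I cell.simps(2))+
  then show False
    using split_disjnt[OF cell_open cell_meets, of \<sigma> k] k(1)
    by (cases "\<sigma> k") (auto simp: disjnt_iff)
qed

text \<open>
  These sets witness the failure of the \<open>\<Delta>\<close>-property. A branch with finitely many entries
  \<open>True\<close> eventually drops out, so the intersection is empty; yet every node lies on a branch
  that is still counted at index \<open>n\<close>, since the number of entries \<open>True\<close> beyond the node is
  free.
\<close>

definition level :: "nat \<Rightarrow> 'a set" where
  "level n = (\<Union>\<sigma>\<in>{\<sigma>. finite {i. \<sigma> i} \<and> n \<le> card {i. \<sigma> i}}. fibre \<sigma>)"

lemma level_subset_topspace: "level n \<subseteq> topspace X"
  using closure_of_subset_topspace[of X] unfolding level_def fibre_def by blast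

lemma decseq_level: "decseq level"
  unfolding decseq_def level_def by (intro allI impI UN_mono) auto

lemma Inter_level: "(\<Inter>n. level n) = {}"
proof (rule ccontr)
  assume "(\<Inter>n. level n) \<noteq> {}"
  then obtain x where x: "\<And>n. x \<in> level n" by blast
  from x[of 0] obtain \<sigma> where \<sigma>: "x \<in> fibre \<sigma>"
    unfolding level_def by blast
  from x[of "Suc (card {i. \<sigma> i})"] obtain \<tau>
    where \<tau>: "x \<in> fibre \<tau>" "Suc (card {i. \<sigma> i}) \<le> card {i. \<tau> i}"
    unfolding level_def by blast
  then show False
    using fibre_inj[OF \<sigma> \<tau>(1)] by simp
qed

text \<open>
  The density step. Continue the given node by \<open>n\<close> entries \<open>True\<close> and then by \<open>False\<close> forever: the
  fibre of this branch lies in \<open>V\<close>, hence so does the closure of one of its cells.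
\<close>

lemma cell_below_with_closure_in:
  assumes cc: "countably_compact_space X" and V: "openin X V" "level n \<subseteq> V"
  obtains \<tau> m where "cell \<tau> m \<subseteq> cell \<sigma> k" "X closure_of cell \<tau> m \<subseteq> V"
proof -
  define \<tau> where "\<tau> = (\<lambda>i. if i < k then \<sigma> i else i < k + n)"
  have "{i. \<tau> i} \<subseteq> {..<k + n}"
    unfolding \<tau>_def by auto
  then have fin: "finite {i. \<tau> i}"
    by (rule finite_subset) simp
  have "{k..<k + n} \<subseteq> {i. \<tau> i}"
    unfolding \<tau>_def by auto
  from card_mono[OF fin this] have "n \<le> card {i. \<tau> i}"
    by simp
  with fin have "fibre \<tau> \<subseteq> level n"
    unfolding level_def by blast
  with V(2) have "(\<Inter>m. X closure_of cell \<tau> m) \<subseteq> V"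
    unfolding fibre_def by blast
  then obtain m where m: "X closure_of cell \<tau> m \<subseteq> V"
    using countably_compact_decseq_closed_subset_open
      [OF cc closedin_closure_of decseq_closure_cell V(1)] by blast
  show thesis
  proof (rule that[of \<tau> "max m k"])
    have "cell \<tau> k = cell \<sigma> k"
      by (rule cell_cong) (simp add: \<tau>_def)
    then show "cell \<tau> (max m k) \<subseteq> cell \<sigma> k"
      using decseqD[OF decseq_cell, of k "max m k" \<tau>] by simp
    show "X closure_of cell \<tau> (max m k) \<subseteq> V"
      using decseqD[OF decseq_closure_cell, of m "max m k" \<tau>] m by simp
  qed
qed

lemma countably_compact_not_Delta_space:
  assumes cc: "countably_compact_space X"
  shows "\<not> Delta_space X"
proof
  assume "Delta_space X"
  then obtain V where V: "\<And>n. openin X (V n)" "(\<Inter>n. V n) = {}" "\<And>n. level n \<subseteq> V n"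
    unfolding Delta_space_def
    using level_subset_topspace decseq_level Inter_level by metis
  let ?node = "\<lambda>W. \<exists>\<sigma> k. W = cell \<sigma> k"
  have "\<exists>W. \<forall>n. (?node (W n) \<and> X closure_of W n \<subseteq> V n) \<and> W (Suc n) \<subseteq> W n"
  proof (rule dependent_nat_choice)
    obtain \<tau> m where "X closure_of cell \<tau> m \<subseteq> V 0"
      using cell_below_with_closure_in[OF cc V(1) V(3)] .
    then show "\<exists>W. ?node W \<and> X closure_of W \<subseteq> V 0"
      by blast
  next
    fix W n assume "?node W \<and> X closure_of W \<subseteq> V n"
    then obtain \<sigma> k where "W = cell \<sigma> k"
      by blast
    moreover obtain \<tau> m
      where "cell \<tau> m \<subseteq> cell \<sigma> k" "X closure_of cell \<tau> m \<subseteq> V (Suc n)"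
      using cell_below_with_closure_in[OF cc V(1) V(3)] .
    ultimately show "\<exists>W'. (?node W' \<and> X closure_of W' \<subseteq> V (Suc n)) \<and> W' \<subseteq> W"
      by blast
  qed
  then obtain W where W: "\<And>n. ?node (W n)" "\<And>n. X closure_of W n \<subseteq> V n"
    "\<And>n. W (Suc n) \<subseteq> W n"
    by blast
  have "decseq (\<lambda>n. X closure_of W n)"
    by (intro decseq_SucI closure_of_mono W(3))
  moreover have "(\<Inter>n. X closure_of W n) \<subseteq> {}"
    using W(2) V(2) by blast
  ultimately obtain n where "X closure_of W n \<subseteq> {}"
    using countably_compact_decseq_closed_subset_open
      [OF cc closedin_closure_of _ openin_empty, of W] by blast
  moreover obtain \<sigma> k where "W n = cell \<sigma> k"
    using W(1) by blast
  ultimately show False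
    using closure_of_subset[OF openin_subset[OF cell_open[of \<sigma> k]]] cell_meets[of \<sigma> k] by auto
qed

end

section \<open>Scatteredness\<close>

lemma countably_compact_regular_Delta_imp_scattered:
  assumes cc: "countably_compact_space X"
    and reg: "regular_space X" and haus: "Hausdorff_space X"
    and Delta: "Delta_space X"
  shows "scattered_space X"
proof (rule ccontr)
  assume "\<not> scattered_space X"
  then obtain A where A: "A \<subseteq> topspace X" "A \<noteq> {}"
    and crowded: "\<And>x. x \<in> A \<Longrightarrow> \<not> openin (subtopology X A) {x}"
    by (auto simp: scattered_space_def)
  let ?split = "\<lambda>U T. (\<forall>b. openin X (T b) \<and> T b \<inter> A \<noteq> {} \<and> X closure_of T b \<subseteq> U) \<and>
      disjnt (X closure_of T False) (X closure_of T True)"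
  have "\<exists>T :: bool \<Rightarrow> 'a set. ?split U T" if U: "openin X U" "U \<inter> A \<noteq> {}" for U
    by (rule crowded_open_split[OF reg haus A(1) crowded U], assumption) blast
  then obtain S :: "'a set \<Rightarrow> bool \<Rightarrow> 'a set"
    where S: "\<And>U. \<lbrakk>openin X U; U \<inter> A \<noteq> {}\<rbrakk> \<Longrightarrow> ?split U (S U)"
    by metis
  have "splitting_scheme X A S"
  proof
    show "topspace X \<inter> A \<noteq> {}"
      using A by blast
  qed (simp_all add: S)
  from splitting_scheme.countably_compact_not_Delta_space[OF this cc] Delta
  show False by contradiction
qed

theorem theorem4p7:
  fixes X :: "'a topology"
  assumes "countably_compact_space X"
    and "Tychonoff_space X"
    and "Delta_space X"
  shows "scattered_space X"
proof -
  have reg: "regular_space X"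
    using assms(2) completely_regular_imp_regular_space unfolding Tychonoff_space_def by blast
  moreover have "Hausdorff_space X"
    using assms(2) regular_t1_imp_Hausdorff_space[OF reg] unfolding Tychonoff_space_def by blast
  ultimately show ?thesis
    using countably_compact_regular_Delta_imp_scattered assms by blast
qed

end
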